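(* Let $K$ be a field and let $q\in K$ be such that $q\neq0$ and $\{n\}_q\neq0$ for every non-zero $n\in\mathbb{Z}$. Let $P\in H_K(q)$ be non-constant (i.e. not a scalar multiple of the identity), of order $m$. Then for all $\lambda\in K$, $$\dim\ker(P-\lambda)\leq|d_{\max}|+|d_{\min}|+m,$$ where the kernel is that of $P-\lambda$ acting on $\mathcal{L}$, and $d_{\max},d_{\min}$ are the integers attached to $P$.
   Context: For $n\in\mathbb{Z}$ the $q$-integer is $\{n\}_q=\frac{q^n-1}{q-1}$ if $q\neq1$ and $\{n\}_q=n$ (in $K$) if $q=1$. $H_K(q)$ is the unital associative $K$-algebra generated by $A,B$ subject to $AB-qBA=I$. Let $\mathcal{L}$ be the $K$-vector space of all formal two-sided Laurent series $\sum_{n=-\infty}^{\infty}a_nt^n$, $a_n\in K$ (all functions $\mathbb{Z}\to K$), with endomorphisms $$M\Big(\sum_n a_nt^n\Big)=\sum_n a_nt^{n+1},\qquad D_q\Big(\sum_n a_nt^n\Big)=\sum_n a_n\{n\}_qt^{n-1}.$$ Sending $A\mapsto D_q$, $B\mapsto M$ makes $\mathcal{L}$ a faithful $H_K(q)$-module, and $H_K(q)$ is identified with its image in $\operatorname{End}_K(\mathcal{L})$. Every non-zero $P\in H_K(q)$ can be written uniquely as $P=\sum_{j=0}^m p_j(M)D_q^j$ with $m\ge0$, $p_j\in K[X]$, $p_m\neq0$; $m$ is the order of $P$. Write $p_j(X)=\sum_ip_{j,i}X^i$ and, for $d,k\in\mathbb{Z}$, put $$\beta_d(k)=\sum_{i-j=d}p_{j,i}\{k\}_q\{k-1\}_q\cdots\{k-j+1\}_q,$$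 where the product of $q$-integers is $1$ if $j=0$; thus $Pt^k=\sum_d\beta_d(k)t^{d+k}$. View $\beta_d$ as a function $\mathbb{Z}\to K$. Put $d_{\max}=\max\{d:\beta_d\neq0\}$ and $d_{\min}=\min\{d:\beta_d\neq0\}$. *)

theory Defs
  imports "HOL-Computational_Algebra.Polynomial" "HOL-Library.Function_Algebras"
begin

definition q_int :: "'a::field \<Rightarrow> int \<Rightarrow> 'a" where
  "q_int q n = (if q = 1 then of_int n else (q powi n - 1) / (q - 1))"

text \<open>
  The field \<open>K\<close> is the type \<open>'a\<close>. A formal two-sided Laurent series is its coefficient
  function; the zero series and addition are the pointwise ones of
  \<^theory>\<open>HOL-Library.Function_Algebras\<close>.
\<close>

type_synonym 'a laurent = "int \<Rightarrow> 'a"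

definition lscale :: "'a::field \<Rightarrow> 'a laurent \<Rightarrow> 'a laurent" where
  "lscale c f = (\<lambda>n. c * f n)"

global_interpretation laurent: vector_space lscale
  by unfold_locales (auto simp: lscale_def fun_eq_iff algebra_simps)

definition M_op :: "'a::field laurent \<Rightarrow> 'a laurent" where
  "M_op f = (\<lambda>n. f (n - 1))"

definition D_op :: "'a::field \<Rightarrow> 'a laurent \<Rightarrow> 'a laurent" where
  "D_op q f = (\<lambda>n. q_int q (n + 1) * f (n + 1))"

text \<open>
  \<open>H_K(q)\<close>, identified with its image under the faithful representation \<open>A \<mapsto> D_q\<close>,
  \<open>B \<mapsto> M\<close>: the unital subalgebra of the endomorphism algebra generated by \<open>D_q\<close> and \<open>M\<close>.
\<close>

inductive_set HK :: "'a::field \<Rightarrow> ('a laurent \<Rightarrow> 'a laurent) set" for q where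
  HK_id: "(\<lambda>f. f) \<in> HK q"
| HK_M: "M_op \<in> HK q"
| HK_D: "D_op q \<in> HK q"
| HK_scale: "P \<in> HK q \<Longrightarrow> (\<lambda>f. lscale c (P f)) \<in> HK q"
| HK_add: "P \<in> HK q \<Longrightarrow> Q \<in> HK q \<Longrightarrow> (\<lambda>f. P f + Q f) \<in> HK q"
| HK_comp: "P \<in> HK q \<Longrightarrow> Q \<in> HK q \<Longrightarrow> (\<lambda>f. P (Q f)) \<in> HK q"

definition poly_M :: "'a::field poly \<Rightarrow> 'a laurent \<Rightarrow> 'a laurent" where
  "poly_M r f = (\<Sum>i\<le>degree r. lscale (coeff r i) ((M_op ^^ i) f))"

text \<open>
  The family \<open>p_0, \<dots>, p_m\<close> with \<open>p_m \<noteq> 0\<close> is encoded as a polynomial \<open>p\<close> of degree \<open>m\<close> with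
  coefficients \<open>p_j \<in> K[X]\<close>; only the coefficients and the degree of \<open>p\<close> are used.
\<close>

definition normal_op :: "'a::field \<Rightarrow> 'a poly poly \<Rightarrow> 'a laurent \<Rightarrow> 'a laurent" where
  "normal_op q p f = (\<Sum>j\<le>degree p. poly_M (coeff p j) ((D_op q ^^ j) f))"

definition normal_form :: "'a::field \<Rightarrow> ('a laurent \<Rightarrow> 'a laurent) \<Rightarrow> 'a poly poly" where
  "normal_form q P = (THE p. normal_op q p = P)"

definition HK_order :: "'a::field \<Rightarrow> ('a laurent \<Rightarrow> 'a laurent) \<Rightarrow> nat" where
  "HK_order q P = degree (normal_form q P)"

definition beta :: "'a::field \<Rightarrow> ('a laurent \<Rightarrow> 'a laurent) \<Rightarrow> int \<Rightarrow> int \<Rightarrow> 'a" where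
  "beta q P d k =
     (let p = normal_form q P in
      \<Sum>j\<le>degree p. \<Sum>i | i \<le> degree (coeff p j) \<and> int i - int j = d.
        coeff (coeff p j) i * (\<Prod>l<j. q_int q (k - int l)))"

definition d_max :: "'a::field \<Rightarrow> ('a laurent \<Rightarrow> 'a laurent) \<Rightarrow> int" where
  "d_max q P = Max {d. beta q P d \<noteq> (\<lambda>k. 0)}"

definition d_min :: "'a::field \<Rightarrow> ('a laurent \<Rightarrow> 'a laurent) \<Rightarrow> int" where
  "d_min q P = Min {d. beta q P d \<noteq> (\<lambda>k. 0)}"

definition eigen_kernel :: "('a::field laurent \<Rightarrow> 'a laurent) \<Rightarrow> 'a \<Rightarrow> 'a laurent set" where
  "eigen_kernel P c = {f. P f - lscale c f = 0}"

text \<open>The description operator in \<^const>\<open>normal_form\<close> is justified by \<open>ex1_normal_form\<close> below.\<close>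

lemma M_add: "M_op (f + g) = M_op f + M_op g"
  and M_scale: "M_op (lscale c f) = lscale c (M_op f)"
  and M_0: "M_op 0 = 0"
  and D_add: "D_op q (f + g) = D_op q f + D_op q g"
  and D_scale: "D_op q (lscale c f) = lscale c (D_op q f)"
  and D_0: "D_op q 0 = 0"
  by (auto simp: M_op_def D_op_def lscale_def fun_eq_iff algebra_simps)

lemma q_int_Suc: "q \<noteq> 0 \<Longrightarrow> q_int q (n + 1) = q * q_int q n + 1"
  by (simp add: q_int_def divide_simps power_int_add) (simp add: algebra_simps)

lemma D_M: "q \<noteq> 0 \<Longrightarrow> D_op q (M_op f) = lscale q (M_op (D_op q f)) + f"
  by (rule ext, simp add: M_op_def D_op_def lscale_def) (simp add: q_int_Suc distrib_right mult.assoc)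

declare plus_fun_apply [simp del] zero_fun_apply [simp del]

lemma poly_M_0: "poly_M 0 f = 0"
  by (simp add: poly_M_def)

lemma M_sum: "M_op (sum g A) = (\<Sum>x\<in>A. M_op (g x))"
  by (induction A rule: infinite_finite_induct) (auto simp: M_add M_0)

lemma poly_M_pCons: "poly_M (pCons c r) f = lscale c f + M_op (poly_M r f)"
proof (cases "r = 0")
  case True
  then show ?thesis by (simp add: poly_M_def M_0)
next
  case False
  then show ?thesis
    by (simp add: poly_M_def M_sum M_scale sum.atMost_Suc_shift del: sum.atMost_Suc)
qed

lemma poly_M_add: "poly_M (r + s) f = poly_M r f + poly_M s f"
  by (induction r s rule: poly_induct2)
    (simp_all add: poly_M_pCons poly_M_0 M_add laurent.scale_left_distrib)

lemma poly_M_smult: "poly_M (smult c r) f = lscale c (poly_M r f)"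
  by (induction r) (simp_all add: poly_M_pCons poly_M_0 M_scale laurent.scale_right_distrib)

lemma poly_M_zero: "poly_M r 0 = 0"
  by (induction r) (simp_all add: poly_M_pCons poly_M_0 M_0)

lemma D_poly_M:
  assumes "q \<noteq> 0"
  shows "\<exists>s s'. \<forall>f. D_op q (poly_M r f) = poly_M s (D_op q f) + poly_M s' f"
proof (induction r)
  case 0
  show ?case by (intro exI[of _ 0]) (simp add: poly_M_0 D_0)
next
  case (pCons c r)
  then obtain s s' where *: "\<And>f. D_op q (poly_M r f) = poly_M s (D_op q f) + poly_M s' f" by blast
  show ?case
    by (rule exI[of _ "pCons c (smult q s)"], rule exI[of _ "pCons 0 (smult q s') + r"])
      (simp add: poly_M_pCons poly_M_add poly_M_smult D_add D_scale D_M assms * M_add M_scale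
        laurent.scale_right_distrib add_ac)
qed

lemma normal_op_0: "normal_op q 0 f = 0"
  by (simp add: normal_op_def poly_M_0)

lemma normal_op_pCons: "normal_op q (pCons r p) f = poly_M r f + normal_op q p (D_op q f)"
proof (cases "p = 0")
  case True
  then show ?thesis by (simp add: normal_op_def poly_M_0)
next
  case False
  then show ?thesis
    by (simp add: normal_op_def sum.atMost_Suc_shift funpow_swap1 del: sum.atMost_Suc)
qed

lemma normal_op_add: "normal_op q (p + r) f = normal_op q p f + normal_op q r f"
  by (induction p r arbitrary: f rule: poly_induct2)
    (simp_all add: normal_op_pCons normal_op_0 poly_M_add add_ac)

lemma normal_op_scale: "normal_op q (smult [:c:] p) f = lscale c (normal_op q p f)"
  by (induction p arbitrary: f)
    (simp_all add: normal_op_pCons normal_op_0 poly_M_smult laurent.scale_right_distrib)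

lemma normal_op_M: "normal_op q (smult [:0, 1:] p) f = M_op (normal_op q p f)"
  by (induction p arbitrary: f)
    (simp_all add: normal_op_pCons normal_op_0 poly_M_pCons M_add M_0)

lemma normal_op_zero: "normal_op q p 0 = 0"
  by (induction p) (simp_all add: normal_op_pCons normal_op_0 poly_M_zero D_0)

lemma normal_op_D:
  assumes "q \<noteq> 0"
  shows "\<exists>s. \<forall>f. D_op q (normal_op q p f) = normal_op q s f"
proof (induction p)
  case 0
  show ?case by (intro exI[of _ 0]) (simp add: normal_op_0 D_0)
next
  case (pCons r p)
  then obtain s where s: "\<And>f. D_op q (normal_op q p f) = normal_op q s f" by blast
  obtain u u' where u: "\<And>f. D_op q (poly_M r f) = poly_M u (D_op q f) + poly_M u' f"
    using D_poly_M[OF assms] by blast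
  show ?case
    by (rule exI[of _ "pCons u' ([:u:] + s)"])
      (simp add: normal_op_pCons normal_op_0 normal_op_add D_add s u add_ac)
qed

lemma HK_normal_op:
  assumes "q \<noteq> 0" "P \<in> HK q"
  shows "\<exists>s. \<forall>f. P (normal_op q p f) = normal_op q s f"
  using assms(2)
proof (induction arbitrary: p)
  case HK_D
  then show ?case using normal_op_D[OF assms(1)] by blast
next
  case (HK_add P Q)
  then show ?case by (metis normal_op_add)
next
  case (HK_comp P Q)
  then show ?case by metis
qed (metis normal_op_scale normal_op_M)+

lemma HK_ex_normal_form:
  assumes "q \<noteq> 0" "P \<in> HK q"
  shows "\<exists>p. normal_op q p = P"
proof -
  have "normal_op q [:1:] f = f" for f
    by (simp add: normal_op_def poly_M_def)
  then show ?thesis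
    using HK_normal_op[OF assms, of "[:1:]"] by (metis ext)
qed

lemma poly_M_monom0:
  "poly_M r (\<lambda>n. if n = 0 then 1 else 0) n = (if n < 0 then 0 else coeff r (nat n))"
proof (induction r arbitrary: n)
  case (pCons a r)
  have "nat n = Suc (nat (n - 1))" if "n > 0"
    using that by simp
  then show ?case
    using pCons.IH[of "n - 1"]
    by (auto simp: poly_M_pCons M_op_def lscale_def plus_fun_apply)
qed (simp add: poly_M_0 zero_fun_apply)

lemma normal_op_eq_0:
  assumes "\<And>n. n \<noteq> 0 \<Longrightarrow> q_int q n \<noteq> 0"
    and "\<And>f. (\<forall>n<0. f n = 0) \<Longrightarrow> normal_op q p f = 0"
  shows "p = 0"
  using assms(2)
proof (induction p)
  case (pCons r p)
  let ?t = "\<lambda>n::int. if n = 0 then 1 else 0 :: 'a"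
  have "D_op q ?t = 0"
    by (auto simp: D_op_def q_int_def fun_eq_iff zero_fun_apply)
  then have "poly_M r ?t = 0"
    using pCons.prems[of ?t] by (simp add: normal_op_pCons normal_op_zero)
  then have r: "r = 0"
    using poly_M_monom0[of r "int k" for k] by (intro poly_eqI) (simp add: zero_fun_apply)
  have "normal_op q p f = 0" if f: "\<forall>n<0. f n = 0" for f
  proof -
    define g where "g n = (if n \<le> 0 then 0 else f (n - 1) / q_int q n)" for n
    have "D_op q g = f"
      using f assms(1) by (auto simp: D_op_def g_def fun_eq_iff)
    moreover have "\<forall>n<0. g n = 0" by (auto simp: g_def)
    ultimately show ?thesis
      using pCons.prems[of g] by (simp add: normal_op_pCons r poly_M_0)
  qed
  then have "p = 0" by (rule pCons.IH)
  with r show ?case by simp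
qed simp

lemma ex1_normal_form:
  assumes "q \<noteq> 0" "\<And>n. n \<noteq> 0 \<Longrightarrow> q_int q n \<noteq> 0" "P \<in> HK q"
  shows "\<exists>!p. normal_op q p = P"
proof (rule ex_ex1I)
  show "\<exists>p. normal_op q p = P" using HK_ex_normal_form assms by blast
next
  fix p r assume *: "normal_op q p = P" "normal_op q r = P"
  have "normal_op q (p - r) f = 0" for f
    using normal_op_add[of q "p - r" r f] * by simp
  then show "p = r" using normal_op_eq_0[OF assms(2), where p = "p - r"] by simp
qed

lemma normal_op_normal_form:
  assumes "q \<noteq> 0" "\<And>n. n \<noteq> 0 \<Longrightarrow> q_int q n \<noteq> 0" "P \<in> HK q"
  shows "normal_op q (normal_form q P) = P"
  unfolding normal_form_def by (rule theI') (rule ex1_normal_form[OF assms])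

declare plus_fun_apply [simp] zero_fun_apply [simp]

end

theory Submission
  imports Defs
begin

text \<open>
  Each \<open>\<beta>\<^sub>d(k)\<close> is a polynomial of degree at most \<open>m\<close> in \<open>{k}\<^sub>q\<close>, and \<open>k \<mapsto> {k}\<^sub>q\<close> is injective, so a
  non-zero \<open>\<beta>\<^sub>d\<close> has at most \<open>m\<close> integer zeros. The equation \<open>(P - \<lambda>) f = 0\<close> is a linear recurrence
  for the coefficients of \<open>f\<close>, whose extreme shifts lie between \<open>min d\<^sub>m\<^sub>i\<^sub>n 0\<close> and \<open>max d\<^sub>m\<^sub>a\<^sub>x 0\<close>.
  Take a window of consecutive positions, as long as the recurrence, to the left of all zeros of the
  highest-shift coefficient. A solution is then determined by its values on the window and at the at
  most \<open>m\<close> zeros of the lowest-shift coefficient: downward the recurrence never degenerates, and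
  upward it degenerates only at those zeros.
\<close>

section \<open>Dimension bounds from finite determining sets\<close>

lemma sum_fun_apply: "sum F A x = (\<Sum>a\<in>A. F a x)"
  by (induction A rule: infinite_finite_induct) auto

text \<open>Restriction to \<open>W\<close> is linear and, by \<open>det\<close>, injective on
  \<open>V\<close>, with image spanned by the unit series at positions in \<open>W\<close>. The
  finite spanning set is asserted separately because \<open>laurent.dim\<close> takes the default
  value 0 on infinite-dimensional spaces.\<close>

lemma laurent_dim_le_card_determining_set:
  fixes V :: "'a::field laurent set"
  assumes V: "laurent.subspace V" and W: "finite W"
    and det: "\<And>f. f \<in> V \<Longrightarrow> (\<And>n. n \<in> W \<Longrightarrow> f n = 0) \<Longrightarrow> f = 0"
  shows "\<exists>B. finite B \<and> laurent.span B = V" and "laurent.dim V \<le> card W"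
proof -
  interpret pair: vector_space_pair "lscale :: 'a \<Rightarrow> _" "lscale :: 'a \<Rightarrow> _" ..
  \<comment> \<open>Restriction is modelled by extension with zero, which stays inside the same
    vector space.\<close>
  define r :: "'a laurent \<Rightarrow> 'a laurent" where "r f = (\<lambda>n. if n \<in> W then f n else 0)" for f
  define delta :: "int \<Rightarrow> 'a laurent" where "delta w = (\<lambda>n. if n = w then 1 else 0)" for w
  obtain B where B: "B \<subseteq> V" "laurent.independent B" "V \<subseteq> laurent.span B" "card B = laurent.dim V"
    using laurent.basis_exists by blast
  have span_B: "laurent.span B = V"
    using B V laurent.span_minimal by blast
  have lin: "Vector_Spaces.linear lscale lscale r"
    by unfold_locales (auto simp: r_def lscale_def fun_eq_iff algebra_simps)
  have inj: "inj_on r (laurent.span B)"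
    unfolding pair.linear_inj_on_iff_eq_0[OF lin V] span_B
  proof (intro ballI impI)
    fix f assume "f \<in> V" "r f = 0"
    moreover have "f n = r f n" if "n \<in> W" for n
      using that by (simp add: r_def)
    ultimately show "f = 0"
      using det[of f] by simp
  qed
  have indep: "laurent.independent (r ` B)"
    using pair.linear_independent_injective_image[OF lin B(2) inj] .
  have "r f \<in> laurent.span (delta ` W)" for f
  proof -
    have "r f = (\<Sum>w\<in>W. lscale (f w) (delta w))"
      using W by (auto simp: r_def delta_def lscale_def fun_eq_iff sum_fun_apply
          if_distrib[of "(*) _"] cong: if_cong)
    then show ?thesis
      by (simp add: laurent.span_sum laurent.span_scale laurent.span_base)
  qed
  then have bound: "finite (r ` B) \<and> card (r ` B) \<le> card (delta ` W)"
    by (intro laurent.independent_span_bound indep) (use W in auto)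
  have injB: "inj_on r B"
    using inj laurent.span_superset inj_on_subset by blast
  show "\<exists>B. finite B \<and> laurent.span B = V"
    using bound injB span_B finite_imageD by blast
  have "card B \<le> card (delta ` W)"
    using bound injB by (simp add: card_image)
  also have "\<dots> \<le> card W"
    using W by (rule card_image_le)
  finally show "laurent.dim V \<le> card W"
    using B(4) by simp
qed

section \<open>Linear recurrences over the integers\<close>

lemma recurrence_solution_eq_0:
  fixes g :: "int \<Rightarrow> int \<Rightarrow> 'a::field"
  assumes "lo \<le> hi"
    and rec: "\<And>n. (\<Sum>d=lo..hi. g d (n - d) * f (n - d)) = 0"
    and hi: "\<And>k. k < a \<Longrightarrow> g hi k \<noteq> 0"
    and window: "\<And>k. a \<le> k \<Longrightarrow> k < a + (hi - lo) \<Longrightarrow> f k = 0"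
    and zeros: "\<And>k. g lo k = 0 \<Longrightarrow> f k = 0"
  shows "f k = 0"
proof -
  have up: "a \<le> k \<longrightarrow> k < b \<longrightarrow> f k = 0" if "b \<ge> a" for b k
    using that
  proof (induction b arbitrary: k rule: int_ge_induct)
    case (step b)
    have "f b = 0" if "b \<ge> a + (hi - lo)"
    proof -
      \<comment> \<open>At \<open>n = b + lo\<close> the recurrence reads positions
        \<open>b - (hi - lo)\<close> to \<open>b\<close>. All but \<open>b\<close> lie in the range
        already known to vanish, leaving \<open>g lo b * f b = 0\<close>; if
        \<open>g lo b = 0\<close>, the hypothesis \<open>zeros\<close> gives
        \<open>f b = 0\<close>.\<close>
      have "(\<Sum>d=lo..hi. g d (b + lo - d) * f (b + lo - d))
          = (\<Sum>d\<in>{lo}. g d (b + lo - d) * f (b + lo - d))"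
        using that \<open>lo \<le> hi\<close> by (intro sum.mono_neutral_right) (auto simp: step.IH)
      then show ?thesis
        using rec[of "b + lo"] zeros[of b] by auto
    qed
    then have "f b = 0"
      using window[of b] step.hyps by linarith
    then show ?case
      using step.IH[of k] by (cases "k = b") auto
  qed simp
  have down: "b \<le> k \<longrightarrow> f k = 0" if "b \<le> a" for b k
    using that
  proof (induction b arbitrary: k rule: int_le_induct)
    case base
    then show ?case using up[of "k + 1" k] by auto
  next
    case (step b)
    \<comment> \<open>Dually, every term but \<open>d = hi\<close> reads a position \<ge>
      \<open>b\<close>, and \<open>g hi (b - 1)\<close> is non-zero since
      \<open>b - 1 < a\<close>.\<close>
    have "(\<Sum>d=lo..hi. g d (b - 1 + hi - d) * f (b - 1 + hi - d))
        = (\<Sum>d\<in>{hi}. g d (b - 1 + hi - d) * f (b - 1 + hi - d))"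
      using \<open>lo \<le> hi\<close> by (intro sum.mono_neutral_right) (auto simp: step.IH)
    then have "f (b - 1) = 0"
      using rec[of "b - 1 + hi"] hi[of "b - 1"] step.hyps by auto
    then show ?case
      using step.IH[of k] by (cases "k = b - 1") auto
  qed
  show ?thesis
    using down[of "min a k" k] by simp
qed

lemma recurrence_solution_space:
  fixes g :: "int \<Rightarrow> int \<Rightarrow> 'a::field"
  assumes "lo \<le> hi"
    and fin_lo: "finite {k. g lo k = 0}" and fin_hi: "finite {k. g hi k = 0}"
  defines "V \<equiv> {f :: 'a laurent. \<forall>n. (\<Sum>d=lo..hi. g d (n - d) * f (n - d)) = 0}"
  shows "\<exists>B. finite B \<and> laurent.span B = V"
    and "int (laurent.dim V) \<le> hi - lo + int (card {k. g lo k = 0})"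
proof -
  obtain a where a: "\<And>k. k < a \<Longrightarrow> g hi k \<noteq> 0"
  proof
    \<comment> \<open>Inserting 0 keeps \<open>Min\<close> meaningful when there are no
      zeros.\<close>
    fix k assume "k < Min (insert 0 {k. g hi k = 0})"
    then show "g hi k \<noteq> 0"
      using fin_hi by (subst (asm) Min_gr_iff) auto
  qed
  define W where "W = {a..<a + (hi - lo)} \<union> {k. g lo k = 0}"
  have W: "finite W"
    using fin_lo by (simp add: W_def)
  have V: "laurent.subspace V"
    by (auto simp: laurent.subspace_def V_def lscale_def distrib_left sum.distrib mult.left_commute
        simp flip: sum_distrib_left)
  have det: "f = 0" if "f \<in> V" "\<And>n. n \<in> W \<Longrightarrow> f n = 0" for f
  proof
    fix k
    show "f k = 0 k"
      using recurrence_solution_eq_0[OF \<open>lo \<le> hi\<close>, of g f a k] that a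
      by (auto simp: V_def W_def)
  qed
  show "\<exists>B. finite B \<and> laurent.span B = V"
    using laurent_dim_le_card_determining_set(1)[OF V W det] .
  have "laurent.dim V \<le> card W"
    using laurent_dim_le_card_determining_set(2)[OF V W det] .
  also have "\<dots> \<le> card {a..<a + (hi - lo)} + card {k. g lo k = 0}"
    unfolding W_def by (rule card_Un_le)
  finally show "int (laurent.dim V) \<le> hi - lo + int (card {k. g lo k = 0})"
    using \<open>lo \<le> hi\<close> by simp
qed

section \<open>Injectivity of q-integers\<close>

lemma q_int_split:
  assumes "q \<noteq> 0"
  shows "q_int q k = q_int q l + q powi l * q_int q (k - l)"
proof (cases "q = 1")
  case False
  have "q powi k = q powi l * q powi (k - l)"
    using assms by (simp flip: power_int_add)
  with False show ?thesis
    by (simp add: q_int_def divide_simps) (simp add: algebra_simps)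
qed (simp add: q_int_def)

text \<open>By \<open>q_int_split\<close>, the values at \<open>k\<close> and \<open>l\<close>
  differ by \<open>q powi l * q_int q (k - l)\<close>.\<close>

lemma q_int_inj:
  assumes "q \<noteq> 0" "\<And>n. n \<noteq> 0 \<Longrightarrow> q_int q n \<noteq> 0"
  shows "inj (q_int q)"
proof (rule injI)
  fix k l assume "q_int q k = q_int q l"
  then have "q_int q (k - l) = 0"
    using q_int_split[OF assms(1), of k l] assms(1) by simp
  then show "k = l"
    using assms(2)[of "k - l"] by auto
qed

section \<open>The functions \<open>beta\<close> as recurrence coefficients and as
  polynomials\<close>

lemma M_op_funpow: "(M_op ^^ i) f n = f (n - int i)"
  by (induction i arbitrary: n) (auto simp: M_op_def algebra_simps)

lemma D_op_funpow:
  "(D_op q ^^ j) f n = (\<Prod>l<j. q_int q (n + int j - int l)) * f (n + int j)"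
  by (induction j arbitrary: n) (auto simp: D_op_def algebra_simps)

lemma normal_op_apply:
  "normal_op q p f n =
    (\<Sum>j\<le>degree p. \<Sum>i\<le>degree (coeff p j). coeff (coeff p j) i *
      (\<Prod>l<j. q_int q (n - (int i - int j) - int l)) * f (n - (int i - int j)))"
  by (simp add: normal_op_def poly_M_def sum_fun_apply lscale_def M_op_funpow D_op_funpow
      mult.assoc algebra_simps)

text \<open>Groups the normal form by the shift \<open>d = i - j\<close>. Any finite
  \<open>R\<close> containing all shifts is allowed, so that the shift 0 of a scalar can be
  adjoined.\<close>

lemma beta_sum_apply:
  assumes "normal_op q (normal_form q P) = P" and "finite R"
    and R: "\<And>i j. j \<le> degree (normal_form q P) \<Longrightarrow> i \<le> degree (coeff (normal_form q P) j) \<Longrightarrow>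
      int i - int j \<in> R"
  shows "P f n = (\<Sum>d\<in>R. beta q P d (n - d) * f (n - d))"
proof -
  define p where "p = normal_form q P"
  define h where "h j i = coeff (coeff p j) i *
      (\<Prod>l<j. q_int q (n - (int i - int j) - int l)) * f (n - (int i - int j))" for i j
  have "P f n = (\<Sum>j\<le>degree p. \<Sum>i\<le>degree (coeff p j). h j i)"
    using normal_op_apply[of q p f n] assms(1) by (simp add: p_def h_def)
  also have "\<dots> = (\<Sum>j\<le>degree p. \<Sum>d\<in>R. \<Sum>i | i \<in> {..degree (coeff p j)} \<and> int i - int j = d. h j i)"
    using R by (intro sum.cong refl sum.group[symmetric] \<open>finite R\<close>) (auto simp: p_def)
  also have "\<dots> = (\<Sum>d\<in>R. \<Sum>j\<le>degree p. \<Sum>i | i \<in> {..degree (coeff p j)} \<and> int i - int j = d. h j i)"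
    by (rule sum.swap)
  also have "\<dots> = (\<Sum>d\<in>R. beta q P d (n - d) * f (n - d))"
    unfolding beta_def Let_def sum_distrib_right p_def[symmetric]
    by (intro sum.cong refl) (auto simp: h_def)
  finally show ?thesis .
qed

text \<open>Since \<open>q_int q (k - l)\<close> equals
  \<open>q powi (-l) * (q_int q k - q_int q l)\<close>, each factor is affine in
  \<open>q_int q k\<close>, so the term for \<open>j\<close> has degree at most
  \<open>j\<close>.\<close>

lemma beta_eq_poly:
  assumes "q \<noteq> 0"
  shows "\<exists>F. degree F \<le> HK_order q P \<and> (\<forall>k. beta q P d k = poly F (q_int q k))"
proof -
  define p where "p = normal_form q P"
  define G where "G j = (\<Prod>l<j. smult (inverse (q powi int l)) [:- q_int q (int l), 1:])" for j
  define F where "F = (\<Sum>j\<le>degree p. \<Sum>i | i \<le> degree (coeff p j) \<and> int i - int j = d.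
        smult (coeff (coeff p j) i) (G j))"
  have "degree (G j) \<le> j" for j
  proof -
    have "degree (G j) \<le> (\<Sum>l<j. degree (smult (inverse (q powi int l)) [:- q_int q (int l), 1:]))"
      unfolding G_def
      by (rule order.trans[OF degree_prod_sum_le]) (simp_all only: o_def finite_lessThan order.refl)
    also have "\<dots> \<le> (\<Sum>l<j. 1)"
      by (intro sum_mono) simp
    finally show ?thesis by simp
  qed
  then have "degree F \<le> degree p"
    unfolding F_def
    by (intro degree_sum_le finite_atMost) (auto intro!: degree_sum_le order.trans[OF degree_smult_le]
        intro: order.trans finite_subset[of _ "{..degree _}"])
  moreover have "poly (G j) (q_int q k) = (\<Prod>l<j. q_int q (k - int l))" for j k
  proof -
    have "q_int q k * inverse (q ^ l) - inverse (q ^ l) * q_int q (int l) = q_int q (k - int l)" for l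
      using q_int_split[OF assms, of k "int l"] assms by (simp add: field_simps)
    then show ?thesis
      by (simp add: G_def poly_prod)
  qed
  then have "\<forall>k. beta q P d k = poly F (q_int q k)"
    by (simp add: beta_def Let_def F_def poly_sum flip: p_def)
  ultimately show ?thesis
    unfolding HK_order_def p_def by blast
qed

lemma card_zeros_poly_inj_le_degree:
  fixes F :: "'a::field poly"
  assumes "inj u" "F \<noteq> 0"
  shows "finite {k. poly F (u k) = 0}" "card {k. poly F (u k) = 0} \<le> degree F"
proof -
  have fin: "finite {x. poly F x = 0}"
    using assms(2) by (rule poly_roots_finite)
  have inj: "inj_on u {k. poly F (u k) = 0}"
    using assms(1) inj_on_subset by blast
  have sub: "u ` {k. poly F (u k) = 0} \<subseteq> {x. poly F x = 0}"
    by auto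
  show "finite {k. poly F (u k) = 0}"
    using inj_on_finite[OF inj sub fin] .
  show "card {k. poly F (u k) = 0} \<le> degree F"
    using card_inj_on_le[OF inj sub fin] card_poly_roots_bound[OF assms(2)] by linarith
qed

section \<open>The kernel as the solution space of a recurrence\<close>

theorem mainTheorem3:
  fixes q :: "'a::field" and P :: "'a laurent \<Rightarrow> 'a laurent"
  assumes "q \<noteq> 0"
    and "\<And>n::int. n \<noteq> 0 \<Longrightarrow> q_int q n \<noteq> 0"
    and "P \<in> HK q"
    and "\<nexists>c. P = lscale c"
    and "HK_order q P = m"
  shows "\<forall>lam::'a.
    (\<exists>B. finite B \<and> laurent.span B = eigen_kernel P lam) \<and>
    int (laurent.dim (eigen_kernel P lam)) \<le> \<bar>d_max q P\<bar> + \<bar>d_min q P\<bar> + int m"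
proof
  fix lam :: 'a
  define p where "p = normal_form q P"
  define T where "T = (\<Union>j\<le>degree p. (\<lambda>i. int i - int j) ` {..degree (coeff p j)})"
  \<comment> \<open>Coefficients of \<open>P - lam\<close>: the scalar alters only the shift 0,
    which may thereby enter or leave the support \<open>S\<close>.\<close>
  define g where "g d k = beta q P d k - (if d = 0 then lam else 0)" for d k
  define S where "S = {d. g d \<noteq> (\<lambda>k. 0)}"
  have T: "finite T"
    by (simp add: T_def)
  have beta_T: "beta q P d = (\<lambda>k. 0)" if "d \<notin> T" for d
    unfolding beta_def Let_def p_def[symmetric]
    by (intro ext sum.neutral ballI) (use that in \<open>auto simp: T_def\<close>)
  have S_sub: "S \<subseteq> insert 0 T"
    using beta_T by (auto simp: S_def g_def)
  have S: "finite S"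
    using S_sub T finite_subset by blast
  have P_eq: "P f n - lam * f n = (\<Sum>d\<in>insert 0 T. g d (n - d) * f (n - d))" for f n
  proof -
    have "P f n = (\<Sum>d\<in>insert 0 T. beta q P d (n - d) * f (n - d))"
      using T by (intro beta_sum_apply normal_op_normal_form assms) (auto simp: T_def p_def)
    moreover have "lam * f n = (\<Sum>d\<in>insert 0 T. (if d = 0 then lam else 0) * f (n - d))"
      using T by (simp add: if_distrib[of "\<lambda>x. x * _"] sum.delta cong: if_cong)
    ultimately show ?thesis
      by (simp add: g_def left_diff_distrib sum_subtractf)
  qed
  have "S \<noteq> {}"
  proof
    assume "S = {}"
    then have "g d k = 0" for d k
      by (auto simp: S_def)
    then have "P = lscale lam"
      using P_eq by (auto simp: fun_eq_iff lscale_def)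
    then show False
      using assms(4) by blast
  qed
  define lo where "lo = Min S"
  define hi where "hi = Max S"
  have mem: "lo \<in> S" "hi \<in> S"
    using S \<open>S \<noteq> {}\<close> by (auto simp: lo_def hi_def)
  have bounds: "lo \<le> d" "d \<le> hi" if "d \<in> S" for d
    using S that by (auto simp: lo_def hi_def)
  have kernel: "eigen_kernel P lam = {f. \<forall>n. (\<Sum>d=lo..hi. g d (n - d) * f (n - d)) = 0}"
  proof -
    have "P f n - lam * f n = (\<Sum>d=lo..hi. g d (n - d) * f (n - d))" for f n
    proof -
      \<comment> \<open>Shifts outside \<open>S\<close> have zero coefficient, so the index set may
        shrink to \<open>S\<close> and then grow to an interval.\<close>
      have "P f n - lam * f n = (\<Sum>d\<in>S. g d (n - d) * f (n - d))"
        unfolding P_eq using T S_sub by (intro sum.mono_neutral_right) (auto simp: S_def)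
      also have "\<dots> = (\<Sum>d=lo..hi. g d (n - d) * f (n - d))"
        using bounds by (intro sum.mono_neutral_left) (auto simp: S_def)
      finally show ?thesis .
    qed
    then show ?thesis
      by (simp add: eigen_kernel_def fun_eq_iff lscale_def)
  qed
  have zeros: "finite {k. g d k = 0} \<and> card {k. g d k = 0} \<le> m" if "d \<in> S" for d
  proof -
    obtain F where F: "degree F \<le> m" "\<And>k. beta q P d k = poly F (q_int q k)"
      using beta_eq_poly[OF assms(1)] assms(5) by blast
    \<comment> \<open>Subtracting a constant keeps the degree at most \<open>m\<close>, even for
      \<open>m = 0\<close>.\<close>
    define G where "G = F - [:if d = 0 then lam else 0:]"
    have G: "g d k = poly G (q_int q k)" for k
      by (simp add: G_def g_def F)
    have "G \<noteq> 0"
      using that G by (auto simp: S_def fun_eq_iff)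
    moreover have "degree G \<le> m"
      unfolding G_def using F(1) by (intro degree_diff_le) auto
    ultimately show ?thesis
      using card_zeros_poly_inj_le_degree[OF q_int_inj[OF assms(1,2)], of G] by (auto simp: G)
  qed
  have fin: "finite {d. beta q P d \<noteq> (\<lambda>k. 0)}"
    using beta_T T by (metis (mono_tags, lifting) finite_subset mem_Collect_eq subsetI)
  have beta_S: "d = 0 \<or> d_min q P \<le> d \<and> d \<le> d_max q P" if "d \<in> S" for d
  proof (cases "d = 0")
    case False
    then have "d \<in> {d. beta q P d \<noteq> (\<lambda>k. 0)}"
      using that by (auto simp: S_def g_def)
    then show ?thesis
      unfolding d_min_def d_max_def using fin Min_le Max_ge by blast
  qed simp
  \<comment> \<open>Each of \<open>lo\<close> and \<open>hi\<close> is 0 or lies between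
    \<open>d_min q P\<close> and \<open>d_max q P\<close>; the absolute values cover the case where
    0 lies outside that range.\<close>
  have width: "hi - lo \<le> \<bar>d_max q P\<bar> + \<bar>d_min q P\<bar>"
    using beta_S[OF mem(1)] beta_S[OF mem(2)] by linarith
  have "lo \<le> hi"
    using bounds mem by blast
  note sol = recurrence_solution_space[of lo hi g, folded kernel]
  show "(\<exists>B. finite B \<and> laurent.span B = eigen_kernel P lam) \<and>
    int (laurent.dim (eigen_kernel P lam)) \<le> \<bar>d_max q P\<bar> + \<bar>d_min q P\<bar> + int m"
  proof
    show "\<exists>B. finite B \<and> laurent.span B = eigen_kernel P lam"
      using sol(1) \<open>lo \<le> hi\<close> zeros mem by blast
    have "int (laurent.dim (eigen_kernel P lam)) \<le> hi - lo + int (card {k. g lo k = 0})"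
      using sol(2) \<open>lo \<le> hi\<close> zeros mem by blast
    then show "int (laurent.dim (eigen_kernel P lam)) \<le> \<bar>d_max q P\<bar> + \<bar>d_min q P\<bar> + int m"
      using zeros[OF mem(1)] width by linarith
  qed
qed

end
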